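(* For primes $p_1<p_2<\dots<p_K$, let $n=\prod_{j=1}^K p_j$. Let $s\in\{1,\dots,K\}$. If $s=K$, let $q$ be any prime such that $q>p_K$. If $s<K$, let $q$ be any prime such that $p_s<q$ and $q\notin\{p_{s+1},\dots,p_K\}$. Let $m=n/p_s$ and $\Delta\ge0$. Then the following hold. (1) $\Psi(qm)\ge\Psi(n)+(q-p_s)\Psi(m)$. (2) If $\Psi(n)\ge\phi(n)+\Delta$, then $\Psi(qm)\ge\phi(qm)+\Delta$. (3) If $\Psi(n)\ge(p_s-1)\Psi(m)+\Delta$, then $\Psi(qm)\ge(q-1)\Psi(m)+\Delta$.
   Context: A subset $B$ of the additive group $\mathbb{C}$ is quasi-independent if, whenever $k\ge1$, $x_1,\dots,x_k\in B$ are distinct, $\epsilon_j\in\{0,1,-1\}$ and $\sum_j\epsilon_jx_j=0$, then all $\epsilon_j=0$. For a positive integer $n$, $\Psi(n)$ denotes the largest cardinality of a quasi-independent subset (of the additive group $\mathbb{C}$) consisting of $n$-th roots of unity. $\phi$ is Euler's totient function. *)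

theory Defs
  imports "HOL-Analysis.Analysis" "HOL-Number_Theory.Number_Theory"
begin

definition quasi_independent :: "complex set \<Rightarrow> bool" where
  "quasi_independent B \<longleftrightarrow>
     (\<forall>k\<ge>1. \<forall>(x :: nat \<Rightarrow> complex) (\<epsilon> :: nat \<Rightarrow> int).
        inj_on x {1..k} \<and> (\<forall>j\<in>{1..k}. x j \<in> B) \<and> (\<forall>j\<in>{1..k}. \<epsilon> j \<in> {0, 1, -1}) \<and>
        (\<Sum>j=1..k. of_int (\<epsilon> j) * x j) = 0 \<longrightarrow>
        (\<forall>j\<in>{1..k}. \<epsilon> j = 0))"

(* Only meaningful for n > 0, where Max ranges over a finite nonempty set (see Psi_attained). *)
definition Psi :: "nat \<Rightarrow> nat" where
  "Psi n = Max {card B | B. B \<subseteq> {z :: complex. z ^ n = 1} \<and> quasi_independent B}"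

lemma Psi_attained:
  assumes "n > 0"
  shows "\<exists>B. B \<subseteq> {z. z ^ n = 1} \<and> quasi_independent B \<and> card B = Psi n"
    and "\<And>B. B \<subseteq> {z. z ^ n = 1} \<Longrightarrow> quasi_independent B \<Longrightarrow> card B \<le> Psi n"
proof -
  let ?S = "{card B | B. B \<subseteq> {z :: complex. z ^ n = 1} \<and> quasi_independent B}"
  have "finite {z :: complex. z ^ n = 1}"
    using assms by (intro finite_roots_unity) auto
  then have fin: "finite ?S"
    by (auto intro: finite_subset [of _ "card ` Pow {z :: complex. z ^ n = 1}"])
  have "quasi_independent {}"
    by (auto simp: quasi_independent_def)
  then have "?S \<noteq> {}"
    by blast
  from Max_in [OF fin this]
  show "\<exists>B. B \<subseteq> {z. z ^ n = 1} \<and> quasi_independent B \<and> card B = Psi n"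
    unfolding Psi_def by (smt (verit) mem_Collect_eq)
  show "card B \<le> Psi n" if "B \<subseteq> {z. z ^ n = 1}" "quasi_independent B" for B
    unfolding Psi_def using that by (intro Max_ge [OF fin]) blast
qed

end

theory Submission
  imports Defs
begin

text \<open>
  Fix a prime \<open>q\<close> that does not divide \<open>m\<close> and a primitive \<open>q\<close>-th root of unity \<open>\<omega>\<close>. Every
  \<open>qm\<close>-th root of unity is \<open>\<omega> ^ a * y\<close> for exactly one \<open>a < q\<close> and one \<open>m\<close>-th root of unity \<open>y\<close>
  (\<open>bij_betw_root_slices\<close>), so a set \<open>B\<close> of \<open>qm\<close>-th roots is the same thing as a family of \<open>q\<close>
  slices \<open>A 0, \<dots>, A (q - 1)\<close>, each a set of \<open>m\<close>-th roots. A signed sum over \<open>B\<close> is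
  \<open>\<Sum>a<q. \<omega> ^ a * c a\<close>, where \<open>c a\<close> is a signed sum over \<open>A a\<close>. Because \<open>\<omega>\<close> has degree \<open>q - 1\<close>
  over the field of \<open>m\<close>-th roots of unity, this vanishes exactly when all \<open>c a\<close> are equal. Hence
  \<open>B\<close> is quasi-independent iff every slice is, and \<open>0\<close> is the only number that is a signed sum
  over every slice (\<open>quasi_independent_slices_iff\<close>).

  The second condition only becomes easier to satisfy when slices are added. Take an optimal set
  for \<open>pm\<close>, keep its \<open>p\<close> slices, and let the remaining \<open>q - p\<close> slices be optimal sets for \<open>m\<close>:
  the result is quasi-independent and yields the first inequality (\<open>Psi_replace_prime\<close>). The other
  two inequalities follow by arithmetic; the one about the totient also needs
  \<open>totient m \<le> Psi m\<close> for squarefree \<open>m\<close>. This holds by induction over the primes, since one empty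
  slice has only the signed sum \<open>0\<close> and therefore allows \<open>q - 1\<close> optimal slices
  (\<open>Psi_times_prime\<close>, \<open>totient_le_Psi\<close>).

  The arithmetic input is the statement on the degree of \<open>\<omega>\<close>. It is used in this form: an integer
  relation between \<open>N\<close>-th roots of unity survives raising all of them to a power \<open>k\<close> that is
  coprime to \<open>N\<close> (\<open>roots_relation_power\<close>). With \<open>k\<close> congruent to \<open>1\<close> modulo \<open>m\<close> and to any
  nonzero \<open>t\<close> modulo \<open>q\<close>, this gives \<open>\<Sum>a<q. \<omega> ^ (t * a) * c a = 0\<close> for \<open>0 < t < q\<close>, and Fourier
  inversion shows that \<open>c\<close> is constant. The conjugation result itself is Landau's argument for the
  irreducibility of the cyclotomic polynomials, in which only large primes occur: if \<open>f z = 0\<close>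
  then \<open>f (z ^ l)\<close> is divisible by the prime \<open>l\<close> in \<open>\<int>[z]\<close>, but the finitely many numbers
  \<open>f (z ^ i)\<close> that are nonzero have only finitely many prime divisors.
\<close>

section \<open>Evaluation of integer polynomials at complex numbers\<close>

definition int_eval :: "int poly \<Rightarrow> complex \<Rightarrow> complex" where
  "int_eval f z = poly (map_poly of_int f) z"

lemma int_eval_simps [simp]:
  "int_eval 0 z = 0" "int_eval (pCons a f) z = of_int a + z * int_eval f z"
  "int_eval (Polynomial.monom a n) z = of_int a * z ^ n"
  by (simp_all add: int_eval_def map_poly_pCons map_poly_monom poly_monom)

lemma int_eval_add [simp]: "int_eval (f + g) z = int_eval f z + int_eval g z"
  by (induction f g rule: poly_induct2) (simp_all add: algebra_simps)

lemma int_eval_smult [simp]: "int_eval (Polynomial.smult c f) z = of_int c * int_eval f z"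
  by (induction f) (simp_all add: algebra_simps)

lemma int_eval_diff [simp]: "int_eval (f - g) z = int_eval f z - int_eval g z"
proof -
  have "f - g = f + Polynomial.smult (-1) g"
    by simp
  then show ?thesis
    by (simp only: int_eval_add int_eval_smult) simp
qed

lemma int_eval_mult [simp]: "int_eval (f * g) z = int_eval f z * int_eval g z"
  by (induction f) (simp_all add: algebra_simps)

lemma int_eval_power [simp]: "int_eval (f ^ n) z = int_eval f z ^ n"
  by (induction n) (simp_all add: one_pCons)

lemma int_eval_sum: "int_eval (\<Sum>i\<in>I. f i) z = (\<Sum>i\<in>I. int_eval (f i) z)"
  by (induction I rule: infinite_finite_induct) simp_all

section \<open>Conjugation of roots of unity\<close>

lemma prime_power_add:
  fixes x y :: "'a :: comm_ring_1"
  assumes "prime l"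
  shows "\<exists>d. (x + y) ^ l = x ^ l + y ^ l + of_nat l * d"
proof -
  have l: "l > 0"
    using assms by (rule prime_gt_0_nat)
  have "of_nat l dvd of_nat (l choose k) * x ^ k * y ^ (l - k)" if "k \<in> {..l} - {0, l}" for k
  proof -
    have "l dvd (l choose k)"
      using that l assms by (intro dvd_choose_prime) auto
    then show ?thesis
      by (auto simp: dvd_def mult.assoc)
  qed
  then have "of_nat l dvd (\<Sum>k\<in>{..l} - {0, l}. of_nat (l choose k) * x ^ k * y ^ (l - k))"
    by (intro dvd_sum) auto
  moreover have "(x + y) ^ l = (\<Sum>k\<in>{..l} - {0, l}. of_nat (l choose k) * x ^ k * y ^ (l - k))
      + (\<Sum>k\<in>{0, l}. of_nat (l choose k) * x ^ k * y ^ (l - k))"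
    unfolding binomial_ring by (rule sum.subset_diff) auto
  ultimately show ?thesis
    using l by (auto simp: dvd_def algebra_simps)
qed

lemma int_fermat:
  assumes "prime l"
  shows "\<exists>b. a ^ l = a + int l * b"
proof -
  define r where "r = nat (a mod int l)"
  have l: "l > 0" "l = Suc (l - 1)"
    using prime_gt_0_nat [OF assms] by auto
  have ar: "[a = int r] (mod int l)"
    using l by (simp add: r_def cong_def)
  have "[r ^ l = r] (mod l)"
  proof (cases "l dvd r")
    case True
    then show ?thesis
      using l by (metis cong_0_iff cong_sym cong_trans dvd_power dvd_trans)
  next
    case False
    have "[r * r ^ (l - 1) = r * 1] (mod l)"
      using fermat_theorem [OF assms False] by (rule cong_scalar_left)
    then show ?thesis
      using l by (metis mult.right_neutral power_Suc)
  qed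
  then have "[int r ^ l = int r] (mod int l)"
    by (metis cong_int_iff of_nat_power)
  with ar have "[a ^ l = a] (mod int l)"
    by (meson cong_pow cong_sym cong_trans)
  then have "int l dvd a ^ l - a"
    by (simp add: cong_iff_dvd_diff)
  then show ?thesis
    by (metis add.commute diff_add_cancel dvdE)
qed

text \<open>
  The Frobenius congruence \<open>f (w ^ l) \<equiv> f w ^ l\<close> modulo \<open>l\<close> with an explicit quotient. The
  quotient \<open>h\<close> is one integer polynomial for all \<open>w\<close>, so for every \<open>w\<close> the difference of the two
  sides lies in \<open>l \<int>[w]\<close>.
\<close>

lemma int_eval_frobenius:
  assumes "prime l"
  shows "\<exists>h. \<forall>w. int_eval f (w ^ l) = int_eval f w ^ l + of_nat l * int_eval h w"
proof (induction f)
  case 0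
  show ?case
    using prime_gt_0_nat [OF assms] by (intro exI [of _ 0]) simp
next
  case (pCons a f)
  obtain h where h: "int_eval f (w ^ l) = int_eval f w ^ l + of_nat l * int_eval h w" for w
    using pCons.IH by blast
  obtain b where b: "a ^ l = a + int l * b"
    using int_fermat [OF assms] by blast
  obtain d where d: "([:a:] + [:0, 1:] * f) ^ l = [:a:] ^ l + ([:0, 1:] * f) ^ l + of_nat l * d"
    using prime_power_add [OF assms] by blast
  have nat_poly: "of_nat l = [:int l:]"
    by (simp add: of_nat_poly)
  have dw: "(of_int a + w * int_eval f w) ^ l
      = of_int a + of_nat l * of_int b + w ^ l * int_eval f w ^ l + of_nat l * int_eval d w" for w
  proof -
    have "(of_int a + w * int_eval f w) ^ l = of_int (a ^ l) + w ^ l * int_eval f w ^ l + of_nat l * int_eval d w"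
      using arg_cong [OF d, of "\<lambda>p. int_eval p w"]
      by (simp only: int_eval_power int_eval_add int_eval_mult nat_poly) (simp add: power_mult_distrib)
    then show ?thesis
      by (simp add: b)
  qed
  show ?case
    by (intro exI [of _ "Polynomial.monom 1 l * h - [:b:] - d"]) (simp add: dw h algebra_simps)
qed

text \<open>
  Let \<open>g\<close> be a nonzero integer polynomial of least degree with root \<open>z\<close>, and \<open>c\<close> its leading
  coefficient. Pseudo-division by \<open>g\<close> brings \<open>f z\<close>, up to a power of \<open>c\<close>, into the form \<open>r z\<close>
  with \<open>degree r < degree g\<close>, and such an \<open>r\<close> is determined by its value at \<open>z\<close>. So a prime
  divisor of \<open>f z\<close> divides the coefficients of \<open>r\<close>, unless it divides \<open>c\<close>.
\<close>

lemma bounded_prime_divisors: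
  assumes g: "g \<noteq> 0" "int_eval g z = 0" and f: "int_eval f z \<noteq> 0"
  shows "\<exists>A. \<forall>l h. prime l \<longrightarrow> int_eval f z = of_nat l * int_eval h z \<longrightarrow> l \<le> A"
proof -
  obtain g where g0: "g \<noteq> 0" "int_eval g z = 0"
    and minimal: "\<And>r. int_eval r z = 0 \<Longrightarrow> Polynomial.degree r < Polynomial.degree g \<Longrightarrow> r = 0"
    using ex_has_least_nat [of "\<lambda>g. g \<noteq> 0 \<and> int_eval g z = 0" g Polynomial.degree] g by (metis not_le)
  define c where "c = Polynomial.lead_coeff g"
  have c: "c \<noteq> 0"
    using g0 by (simp add: c_def)
  have reduce: "\<exists>k r. of_int c ^ k * int_eval f z = int_eval r z \<and> (r = 0 \<or> Polynomial.degree r < Polynomial.degree g)" for f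
  proof -
    obtain q r where qr: "pseudo_divmod f g = (q, r)"
      by fastforce
    let ?k = "Suc (Polynomial.degree f) - Polynomial.degree g"
    have "Polynomial.smult (c ^ ?k) f = g * q + r"
      using pseudo_divmod(1) [OF g0(1) qr] by (simp add: c_def)
    then have "int_eval (Polynomial.smult (c ^ ?k) f) z = int_eval (g * q + r) z"
      by (rule arg_cong [of _ _ "\<lambda>p. int_eval p z"])
    then have "of_int c ^ ?k * int_eval f z = int_eval r z"
      using g0(2) by (simp only: int_eval_smult int_eval_add int_eval_mult of_int_power) simp
    with pseudo_divmod(2) [OF g0(1) qr] show ?thesis
      by blast
  qed
  obtain i r where r: "of_int c ^ i * int_eval f z = int_eval r z" "r = 0 \<or> Polynomial.degree r < Polynomial.degree g"
    using reduce by blast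
  have "r \<noteq> 0"
    using r f c by auto
  then have rc: "Polynomial.lead_coeff r \<noteq> 0"
    by simp
  have "l \<le> nat \<bar>c * Polynomial.lead_coeff r\<bar>"
    if l: "prime l" and h: "int_eval f z = of_nat l * int_eval h z" for l h
  proof -
    obtain j r' where r': "of_int c ^ j * int_eval h z = int_eval r' z" "r' = 0 \<or> Polynomial.degree r' < Polynomial.degree g"
      using reduce by blast
    \<comment> \<open>Both reductions are compared after clearing the powers of \<open>c\<close>; the two sides agree at \<open>z\<close>,
      and their difference has too small a degree to vanish there without being zero.\<close>
    let ?D = "Polynomial.smult (c ^ j) r - Polynomial.smult (int l * c ^ i) r'"
    have "int_eval ?D z = 0"
      by (simp flip: r r') (simp add: h)
    moreover have "Polynomial.degree ?D < Polynomial.degree g \<or> ?D = 0"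
    proof (cases "Polynomial.degree g = 0")
      case False
      then have "Polynomial.degree r < Polynomial.degree g" "Polynomial.degree r' < Polynomial.degree g"
        using r(2) r'(2) by auto
      then show ?thesis
        by (meson degree_diff_less degree_smult_le le_less_trans)
    qed (use r(2) r'(2) in auto)
    ultimately have "?D = 0"
      using minimal by blast
    then have "Polynomial.smult (c ^ j) r = Polynomial.smult (int l * c ^ i) r'"
      by simp
    then have "poly.coeff (Polynomial.smult (c ^ j) r) (Polynomial.degree r)
        = poly.coeff (Polynomial.smult (int l * c ^ i) r') (Polynomial.degree r)"
      by (rule arg_cong [of _ _ "\<lambda>p. poly.coeff p (Polynomial.degree r)"])
    then have "c ^ j * Polynomial.lead_coeff r = int l * c ^ i * poly.coeff r' (Polynomial.degree r)"
      by simp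
    then have "int l dvd c ^ j * Polynomial.lead_coeff r"
      by simp
    then have "int l dvd c * Polynomial.lead_coeff r"
      using l by (metis prime_dvd_mult_iff prime_dvd_power prime_nat_int_transfer dvd_mult dvd_mult2)
    then have "\<bar>int l\<bar> \<le> \<bar>c * Polynomial.lead_coeff r\<bar>"
      using c rc by (intro dvd_imp_le_int) auto
    then show ?thesis
      by linarith
  qed
  then show ?thesis
    by blast
qed

text \<open>
  Let \<open>M\<close> bound the primes that divide a nonzero \<open>f (z ^ i)\<close>. For a prime \<open>l > M\<close>, the Frobenius
  congruence carries the vanishing of \<open>f\<close> at \<open>z ^ i\<close> over to \<open>z ^ (i * l)\<close>. So \<open>f (z ^ k') = 0\<close>
  whenever all prime factors of \<open>k'\<close> exceed \<open>M\<close>, and every residue class that is coprime to \<open>N\<close>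
  contains such a \<open>k'\<close>.
\<close>

lemma int_eval_conjugate:
  assumes z: "z ^ N = 1" "N > 0" and "coprime k N" and f: "int_eval f z = 0"
  shows "int_eval f (z ^ k) = 0"
proof -
  have root_poly: "Polynomial.monom 1 N - 1 \<noteq> (0 :: int poly)"
    using z(2) by (metis degree_1 degree_monom_eq eq_iff_diff_eq_0 less_not_refl one_neq_zero)
  have root_eval: "int_eval (Polynomial.monom 1 N - 1) z = 0"
    using z by (simp add: one_pCons)
  have sub: "\<exists>h'. int_eval h (z ^ i) = int_eval h' z" for h i
  proof (induction h)
    case 0
    show ?case
      by (intro exI [of _ 0]) simp
  next
    case (pCons a h)
    then obtain h' where "int_eval h (z ^ i) = int_eval h' z"
      by blast
    then show ?case
      by (intro exI [of _ "[:a:] + Polynomial.monom 1 i * h'"]) simp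
  qed
  have "\<exists>A. \<forall>l h. prime l \<longrightarrow> int_eval f (z ^ i) \<noteq> 0 \<longrightarrow>
      int_eval f (z ^ i) = of_nat l * int_eval h z \<longrightarrow> l \<le> A" for i
    using sub [of f i] bounded_prime_divisors [OF root_poly root_eval] by metis
  then obtain A where A: "\<And>i l h. prime l \<Longrightarrow> int_eval f (z ^ i) \<noteq> 0 \<Longrightarrow>
      int_eval f (z ^ i) = of_nat l * int_eval h z \<Longrightarrow> l \<le> A i"
    by metis
  define M where "M = Max (A ` {..<N})"
  have M: "A i \<le> M" if "i < N" for i
    unfolding M_def using that by (intro Max_ge) auto
  have z_mod: "z ^ i = z ^ (i mod N)" for i
    by (metis mod_div_decomp mult.commute mult_1 power_add power_mult power_one z(1) add.commute)
  have step: "int_eval f (z ^ (i * l)) = 0" if l: "prime l" "l > M" and i: "int_eval f (z ^ i) = 0" for i l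
  proof (rule ccontr)
    assume nz: "int_eval f (z ^ (i * l)) \<noteq> 0"
    obtain h where "int_eval f ((z ^ i) ^ l) = int_eval f (z ^ i) ^ l + of_nat l * int_eval h (z ^ i)"
      using int_eval_frobenius [OF l(1)] by blast
    then have "int_eval f (z ^ (i * l)) = of_nat l * int_eval h (z ^ i)"
      using i prime_gt_0_nat [OF l(1)] by (simp add: power_mult)
    with sub [of h i] nz A [of l "(i * l) mod N"] l(1) have "l \<le> A ((i * l) mod N)"
      by (metis z_mod)
    also have "\<dots> \<le> M"
      using z(2) by (intro M) auto
    finally show False
      using l(2) by simp
  qed
  have large: "(\<And>l. prime l \<Longrightarrow> l dvd i \<Longrightarrow> l > M) \<Longrightarrow> i > 0 \<Longrightarrow> int_eval f (z ^ i) = 0" for i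
  proof (induction i rule: prime_divisors_induct)
    case (factor l x)
    have "int_eval f (z ^ (x * l)) = 0"
      using factor by (intro step) auto
    then show ?case
      by (simp add: mult.commute)
  qed (use f in auto)
  \<comment> \<open>A prime \<open>l \<le> M\<close> divides exactly one of the two summands of \<open>k'\<close>: if it divides \<open>k\<close>, it
    divides neither \<open>N\<close> nor \<open>\<Prod>P\<close>, and otherwise it divides \<open>\<Prod>P\<close>. So
    it does not divide \<open>k'\<close>.\<close>
  define P where "P = {l. prime l \<and> l \<le> M \<and> \<not> l dvd k}"
  define k' where "k' = k + N * \<Prod>P"
  have finP: "finite P"
    by (simp add: P_def)
  have "l > M" if l: "prime l" "l dvd k'" for l
  proof (rule ccontr)
    assume "\<not> l > M"
    show False
    proof (cases "l dvd k")
      case True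
      then have "l dvd N * \<Prod>P"
        using l(2) by (simp add: k'_def dvd_add_right_iff)
      moreover have "\<not> l dvd N"
        using True l(1) \<open>coprime k N\<close> by (metis coprime_common_divisor not_prime_unit)
      ultimately have "l dvd \<Prod>P"
        using l(1) prime_dvd_mult_iff by blast
      then obtain l' where "l' \<in> P" "l dvd l'"
        using prime_dvd_prod_iff [OF finP l(1), of "\<lambda>x. x"] by auto
      then have "l' = l"
        using l(1) primes_dvd_imp_eq by (auto simp: P_def)
      then show False
        using True \<open>l' \<in> P\<close> by (simp add: P_def)
    next
      case False
      then have "l \<in> P"
        using l \<open>\<not> l > M\<close> by (simp add: P_def)
      then have "l dvd \<Prod>P"
        by (intro dvd_prodI [OF finP, of l "\<lambda>x. x", simplified])
      then show False
        using l(2) False by (simp add: k'_def dvd_add_left_iff)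
    qed
  qed
  moreover have "k' > 0"
  proof -
    have "\<Prod>P > 0"
      by (intro prod_pos) (auto simp: P_def prime_gt_0_nat)
    then show ?thesis
      using z(2) by (simp add: k'_def)
  qed
  ultimately have "int_eval f (z ^ k') = 0"
    by (rule large)
  then show ?thesis
    using z(1) by (simp add: k'_def power_add power_mult)
qed

text \<open>
  All the \<open>x i\<close> are powers of a single root of unity \<open>z\<close>, so the relation says that an integer
  polynomial vanishes at \<open>z\<close>, and the conclusion that it vanishes at \<open>z ^ k\<close>.
\<close>

lemma roots_relation_power:
  fixes x :: "'i \<Rightarrow> complex" and e :: "'i \<Rightarrow> int"
  assumes N: "N > 0" "\<And>i. i \<in> I \<Longrightarrow> x i ^ N = 1" and k: "coprime k N"
    and rel: "(\<Sum>i\<in>I. of_int (e i) * x i) = 0"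
  shows "(\<Sum>i\<in>I. of_int (e i) * x i ^ k) = 0"
proof -
  define z :: complex where "z = exp (2 * of_real pi * \<i> / of_nat N)"
  have z_pow: "z ^ j = exp (2 * of_real pi * \<i> * of_nat j / of_nat N)" for j
    by (simp add: z_def mult_ac flip: exp_of_nat_mult)
  have "z ^ N = 1"
    using N(1) z_pow [of N] by simp
  have "\<exists>j. x i = z ^ j" if "i \<in> I" for i
    using complex_roots_unity [of N] N that z_pow by fastforce
  then obtain n where n: "\<And>i. i \<in> I \<Longrightarrow> x i = z ^ n i"
    by metis
  define f where "f = (\<Sum>i\<in>I. Polynomial.monom (e i) (n i))"
  have "int_eval f z = 0"
    using rel n by (simp add: f_def int_eval_sum)
  then have "int_eval f (z ^ k) = 0"
    using int_eval_conjugate \<open>z ^ N = 1\<close> N(1) k by blast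
  then show ?thesis
    using n by (simp add: f_def int_eval_sum mult.commute flip: power_mult)
qed

section \<open>Roots of unity of prime order\<close>

lemma root_power_eq_1_iff:
  fixes \<omega> :: complex
  assumes "prime q" "\<omega> ^ q = 1" "\<omega> \<noteq> 1"
  shows "\<omega> ^ j = 1 \<longleftrightarrow> q dvd j"
proof
  assume one: "\<omega> ^ j = 1"
  show "q dvd j"
  proof (rule ccontr)
    assume "\<not> q dvd j"
    then have "coprime j q"
      using assms(1) prime_imp_coprime coprime_commute by blast
    then obtain x where "[j * x = Suc 0] (mod q)"
      using cong_solve_coprime_nat by blast
    then have "j * x mod q = 1"
      using prime_gt_1_nat [OF assms(1)] by (simp add: cong_def)
    then have "j * x = q * (j * x div q) + 1"
      by (metis mult_div_mod_eq)
    then have "\<omega> ^ (j * x) = \<omega>"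
      using assms(2) by (metis mult_1 power_add power_mult power_one power_one_right)
    then show False
      using one assms(3) by (simp add: power_mult)
  qed
next
  assume "q dvd j"
  then show "\<omega> ^ j = 1"
    using assms(2) by (auto simp: power_mult)
qed

lemma root_power_cong:
  fixes \<omega> :: complex
  assumes "\<omega> ^ q = 1" "[i = j] (mod q)"
  shows "\<omega> ^ i = \<omega> ^ j"
proof -
  have "\<omega> ^ i = \<omega> ^ (i mod q)" for i
    using assms(1) by (metis mult_1 mult_div_mod_eq power_add power_mult power_one)
  then show ?thesis
    using assms(2) by (metis cong_def)
qed

lemma sum_root_powers:
  fixes \<omega> :: complex
  assumes "\<omega> ^ q = 1" "\<omega> \<noteq> 1"
  shows "(\<Sum>t<q. \<omega> ^ t) = 0"
  by (simp add: geometric_sum [OF assms(2)] assms(1))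

lemma prime_root_exists:
  assumes "prime q"
  obtains \<omega> :: complex where "\<omega> ^ q = 1" "\<omega> \<noteq> 1"
proof -
  have "card {z :: complex. z ^ q = 1} = q"
    using prime_gt_0_nat [OF assms] by (rule card_roots_unity_eq)
  then have "\<not> {z :: complex. z ^ q = 1} \<subseteq> {1}"
    using card_mono [of "{1 :: complex}" "{z. z ^ q = 1}"] prime_gt_1_nat [OF assms] by auto
  then show thesis
    using that by blast
qed

text \<open>
  The conjugations that fix the \<open>m\<close>-th roots of
  unity and send \<open>\<omega>\<close> to \<open>\<omega> ^ t\<close> show that all Fourier coefficients of the sequence of slice sums
  vanish, except the one at \<open>t = 0\<close>.
\<close>

lemma slice_sums_equal:
  fixes \<omega> :: complex and A :: "nat \<Rightarrow> complex set" and e :: "nat \<Rightarrow> complex \<Rightarrow> int"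
  assumes q: "prime q" and m: "coprime q m" "m > 0" and \<omega>: "\<omega> ^ q = 1" "\<omega> \<noteq> 1"
    and A: "\<And>a. a < q \<Longrightarrow> A a \<subseteq> {y. y ^ m = 1}"
    and rel: "(\<Sum>a<q. \<omega> ^ a * (\<Sum>y\<in>A a. of_int (e a y) * y)) = 0"
    and ab: "a < q" "b < q"
  shows "(\<Sum>y\<in>A a. of_int (e a y) * y) = (\<Sum>y\<in>A b. of_int (e b y) * y)"
proof -
  define c where "c a = (\<Sum>y\<in>A a. of_int (e a y) * y)" for a
  have finA: "finite (A a)" if "a < q" for a
    using A [OF that] finite_roots_unity [of m] m(2) finite_subset by fastforce
  have conj: "(\<Sum>a<q. (\<omega> ^ t) ^ a * c a) = 0" if t: "0 < t" "t < q" for t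
  proof -
    obtain k where k: "[k = t] (mod q)" "[k = 1] (mod m)"
      using binary_chinese_remainder_nat [OF m(1)] by blast
    have "coprime t q"
      using t q by (metis coprime_commute nat_dvd_not_less prime_imp_coprime)
    then have "coprime k (q * m)"
      using k by (metis cong_imp_coprime cong_sym coprime_1_left coprime_mult_right_iff)
    moreover have "(\<Sum>(a, y)\<in>Sigma {..<q} A. of_int (e a y) * (\<omega> ^ a * y)) = 0"
      using rel finA by (simp add: sum_distrib_left mult_ac flip: sum.Sigma)
    moreover have "(\<omega> ^ a * y) ^ (q * m) = 1" if "(a, y) \<in> Sigma {..<q} A" for a y
    proof -
      have "y ^ m = 1"
        using that A by auto
      then show ?thesis
        using \<omega>(1) by (metis mult.commute mult_1 power_mult power_mult_distrib power_one)
    qed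
    ultimately have pow_rel: "(\<Sum>i\<in>Sigma {..<q} A. of_int (e (fst i) (snd i)) * (\<omega> ^ fst i * snd i) ^ k) = 0"
      using prime_gt_0_nat [OF q] m(2)
      by (intro roots_relation_power [of "q * m"]) (auto simp: case_prod_unfold)
    have conj_eq: "(\<omega> ^ a * y) ^ k = (\<omega> ^ t) ^ a * y" if "(a, y) \<in> Sigma {..<q} A" for a y
    proof -
      have "y ^ k = y"
        using root_power_cong [OF _ k(2), of y] that A by auto
      moreover have "(\<omega> ^ a) ^ k = (\<omega> ^ t) ^ a"
        using root_power_cong [OF \<omega>(1) k(1)] by (metis mult.commute power_mult)
      ultimately show ?thesis
        by (simp add: power_mult_distrib)
    qed
    have "(\<Sum>(a, y)\<in>Sigma {..<q} A. of_int (e a y) * ((\<omega> ^ t) ^ a * y))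
        = (\<Sum>i\<in>Sigma {..<q} A. of_int (e (fst i) (snd i)) * (\<omega> ^ fst i * snd i) ^ k)"
      by (rule sum.cong) (use conj_eq in auto)
    also note pow_rel
    finally have "(\<Sum>(a, y)\<in>Sigma {..<q} A. of_int (e a y) * ((\<omega> ^ t) ^ a * y)) = 0" .
    then show ?thesis
      using finA by (simp add: c_def sum_distrib_left mult_ac flip: sum.Sigma)
  qed
  \<comment> \<open>Fourier inversion; the exponent \<open>q - b\<close> stands for \<open>- b\<close>, so that all exponents are natural.\<close>
  have "of_nat q * c b = (\<Sum>a<q. c a)" if b: "b < q" for b
  proof -
    have ortho: "(\<Sum>t<q. \<omega> ^ (t * (q - b + a))) = (if a = b then of_nat q else 0)" if a: "a < q" for a
    proof -
      have "q dvd q - b + a \<longleftrightarrow> a = b"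
      proof
        assume "q dvd q - b + a"
        show "a = b"
        proof (cases "a < b")
          case True
          then have "0 < q - b + a" "q - b + a < q"
            using b by auto
          then have "\<not> q dvd q - b + a"
            by (rule nat_dvd_not_less)
          then show ?thesis
            using \<open>q dvd q - b + a\<close> by contradiction
        next
          case False
          then have "q - b + a = q + (a - b)"
            using b by simp
          then have "q dvd a - b"
            using \<open>q dvd q - b + a\<close> by (simp add: dvd_add_right_iff)
          then have "a - b = 0"
            using a nat_dvd_not_less [of "a - b" q] by linarith
          then show ?thesis
            using False by simp
        qed
      qed (use b in auto)
      then have "\<omega> ^ (q - b + a) = 1 \<longleftrightarrow> a = b"
        using root_power_eq_1_iff [OF q \<omega>] by blast
      moreover have "(\<omega> ^ (q - b + a)) ^ q = 1"
        using \<omega>(1) by (metis mult.commute power_mult power_one)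
      moreover have "\<omega> ^ (t * (q - b + a)) = (\<omega> ^ (q - b + a)) ^ t" for t
        by (metis mult.commute power_mult)
      ultimately show ?thesis
        using sum_root_powers [of "\<omega> ^ (q - b + a)" q] by auto
    qed
    have "(\<Sum>t<q. \<omega> ^ (t * (q - b)) * (\<Sum>a<q. (\<omega> ^ t) ^ a * c a))
        = (\<Sum>a<q. c a * (\<Sum>t<q. \<omega> ^ (t * (q - b + a))))"
      unfolding sum_distrib_left
      by (subst sum.swap) (simp add: power_add power_mult algebra_simps)
    also have "\<dots> = (\<Sum>a<q. if a = b then of_nat q * c b else 0)"
      by (rule sum.cong) (simp_all add: ortho)
    also have "\<dots> = of_nat q * c b"
      using b by simp
    finally have "of_nat q * c b = (\<Sum>t<q. \<omega> ^ (t * (q - b)) * (\<Sum>a<q. (\<omega> ^ t) ^ a * c a))" ..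
    also have "\<dots> = (\<Sum>t<q. if t = 0 then (\<Sum>a<q. c a) else 0)"
      using conj by (intro sum.cong) auto
    also have "\<dots> = (\<Sum>a<q. c a)"
      using b by simp
    finally show ?thesis .
  qed
  then have "of_nat q * c a = of_nat q * c b"
    using ab by simp
  then show ?thesis
    using ab by (simp add: c_def)
qed

section \<open>Quasi-independence of families of slices\<close>

text \<open>
  The definition indexes the elements of a set by an initial segment of the natural numbers. For
  a finite set any other injective indexing serves as well; in particular its elements may index
  themselves, or pairs \<open>(a, y)\<close> may index the roots of unity \<open>\<omega> ^ a * y\<close>.
\<close>

lemma quasi_independent_image_iff:
  fixes x :: "'i \<Rightarrow> complex"
  assumes fin: "finite I" and inj: "inj_on x I"
  shows "quasi_independent (x ` I) \<longleftrightarrow>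
    (\<forall>e :: 'i \<Rightarrow> int. (\<forall>i\<in>I. e i \<in> {0, 1, -1}) \<and> (\<Sum>i\<in>I. of_int (e i) * x i) = 0 \<longrightarrow> (\<forall>i\<in>I. e i = 0))"
    (is "_ \<longleftrightarrow> ?R")
proof
  assume qi: "quasi_independent (x ` I)"
  show ?R
  proof (intro allI impI, elim conjE)
    fix e :: "'i \<Rightarrow> int"
    assume e: "\<forall>i\<in>I. e i \<in> {0, 1, -1}" "(\<Sum>i\<in>I. of_int (e i) * x i) = 0"
    show "\<forall>i\<in>I. e i = 0"
    proof (cases "I = {}")
      case False
      then have k: "card I \<ge> 1"
        using fin by (simp add: Suc_leI card_gt_0_iff)
      obtain h where h: "bij_betw h {1..card I} I"
        using ex_bij_betw_nat_finite_1 [OF fin] by blast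
      have "inj_on (x \<circ> h) {1..card I}"
        using h inj by (simp add: bij_betw_def comp_inj_on)
      moreover have hI: "h j \<in> I" if "j \<in> {1..card I}" for j
        using h that by (rule bij_betwE [THEN bspec])
      then have "\<forall>j\<in>{1..card I}. (x \<circ> h) j \<in> x ` I"
        by simp
      moreover have "\<forall>j\<in>{1..card I}. (e \<circ> h) j \<in> {0, 1, -1}"
        using hI e(1) unfolding comp_def by blast
      moreover have "(\<Sum>j=1..card I. of_int ((e \<circ> h) j) * (x \<circ> h) j) = 0"
        using sum.reindex_bij_betw [OF h, of "\<lambda>i. of_int (e i) * x i"] e(2) by simp
      ultimately have "\<forall>j\<in>{1..card I}. (e \<circ> h) j = 0"
        using qi k unfolding quasi_independent_def by blast
      then show ?thesis
        using h by (metis bij_betw_iff_bijections comp_apply)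
    qed simp
  qed
next
  assume R: ?R
  show "quasi_independent (x ` I)"
    unfolding quasi_independent_def
  proof (intro allI impI, elim conjE)
    fix k :: nat and w :: "nat \<Rightarrow> complex" and \<epsilon> :: "nat \<Rightarrow> int"
    assume w: "inj_on w {1..k}" "\<forall>j\<in>{1..k}. w j \<in> x ` I"
      and \<epsilon>: "\<forall>j\<in>{1..k}. \<epsilon> j \<in> {0, 1, -1}" "(\<Sum>j=1..k. of_int (\<epsilon> j) * w j) = 0"
    have "\<forall>j\<in>{1..k}. \<exists>i. i \<in> I \<and> w j = x i"
      using w(2) by blast
    then obtain g where "\<forall>j\<in>{1..k}. g j \<in> I \<and> w j = x (g j)"
      by (rule bchoice [THEN exE])
    then have g: "g j \<in> I \<and> w j = x (g j)" if "j \<in> {1..k}" for j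
      using that by blast
    have inj_g: "inj_on g {1..k}"
      using w(1) g by (metis inj_on_def)
    define e where "e i = (if i \<in> g ` {1..k} then \<epsilon> (the_inv_into {1..k} g i) else 0)" for i
    have eg: "e (g j) = \<epsilon> j" if "j \<in> {1..k}" for j
      using that inj_g by (simp add: e_def the_inv_into_f_f)
    have e_values: "\<forall>i\<in>I. e i \<in> {0, 1, -1}"
    proof
      fix i
      assume "i \<in> I"
      show "e i \<in> {0, 1, -1}"
      proof (cases "i \<in> g ` {1..k}")
        case True
        then obtain j where "j \<in> {1..k}" "i = g j"
          by blast
        then show ?thesis
          using eg \<epsilon>(1) by simp
      qed (simp add: e_def)
    qed
    have "(\<Sum>i\<in>I. of_int (e i) * x i) = (\<Sum>i\<in>g ` {1..k}. of_int (e i) * x i)"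
      using g fin by (intro sum.mono_neutral_right) (auto simp: e_def)
    also have "\<dots> = (\<Sum>j\<in>{1..k}. of_int (e (g j)) * x (g j))"
      by (rule sum.reindex [OF inj_g, unfolded comp_def])
    also have "\<dots> = (\<Sum>j\<in>{1..k}. of_int (\<epsilon> j) * w j)"
      using g eg by (intro sum.cong) auto
    also note \<epsilon>(2)
    finally have "(\<Sum>i\<in>I. of_int (e i) * x i) = 0" .
    with e_values have "\<forall>i\<in>I. e i = 0"
      using R by blast
    then show "\<forall>j\<in>{1..k}. \<epsilon> j = 0"
      using g eg by metis
  qed
qed

lemma quasi_independent_iff:
  assumes "finite B"
  shows "quasi_independent B \<longleftrightarrow>
    (\<forall>e :: complex \<Rightarrow> int. (\<forall>y\<in>B. e y \<in> {0, 1, -1}) \<and> (\<Sum>y\<in>B. of_int (e y) * y) = 0 \<longrightarrow> (\<forall>y\<in>B. e y = 0))"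
  using quasi_independent_image_iff [OF assms, of "\<lambda>y. y"] by simp

definition signed_sums :: "complex set \<Rightarrow> complex set" where
  "signed_sums B = {(\<Sum>y\<in>B. of_int (e y) * y) | e :: complex \<Rightarrow> int. \<forall>y\<in>B. e y \<in> {0, 1, -1}}"

text \<open>
  Raising \<open>\<omega> ^ a * y\<close> to the power \<open>m\<close> leaves \<open>\<omega> ^ (a * m)\<close>, which determines \<open>a < q\<close> because
  \<open>m\<close> is invertible modulo \<open>q\<close>. So the map is injective, and it is surjective by counting.
\<close>

lemma bij_betw_root_slices:
  fixes \<omega> :: complex
  assumes q: "prime q" and m: "coprime q m" "m > 0" and \<omega>: "\<omega> ^ q = 1" "\<omega> \<noteq> 1"
  shows "bij_betw (\<lambda>(a, y). \<omega> ^ a * y) ({..<q} \<times> {y. y ^ m = 1}) {z. z ^ (q * m) = 1}"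
proof -
  let ?f = "\<lambda>(a, y). \<omega> ^ a * y" and ?X = "{..<q} \<times> {y :: complex. y ^ m = 1}"
  have \<omega>0: "\<omega> \<noteq> 0"
    using \<omega>(1) prime_gt_0_nat [OF q] by (auto simp: power_0_left)
  have less: "a = b" if eq: "\<omega> ^ a * y = \<omega> ^ b * y'" and y: "y ^ m = 1" "y' ^ m = 1" and ab: "a \<le> b" "b < q"
    for a b y y'
  proof -
    have "\<omega> ^ (a * m) = \<omega> ^ (b * m)"
      using arg_cong [OF eq, of "\<lambda>u. u ^ m"] y by (simp add: power_mult_distrib power_mult)
    then have "\<omega> ^ ((b - a) * m) = 1"
      using ab(1) \<omega>0 by (simp add: diff_mult_distrib power_diff)
    then have "q dvd (b - a) * m"
      using root_power_eq_1_iff [OF q \<omega>] by blast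
    then have "q dvd b - a"
      using m(1) coprime_dvd_mult_left_iff by blast
    then show ?thesis
      using ab nat_dvd_not_less [of "b - a" q] by linarith
  qed
  have "inj_on ?f ?X"
  proof (rule inj_onI)
    fix u v
    assume uv: "u \<in> ?X" "v \<in> ?X" "?f u = ?f v"
    obtain a y b y' where split: "u = (a, y)" "v = (b, y')"
      by (cases u; cases v)
    then have *: "a < q" "b < q" "y ^ m = 1" "y' ^ m = 1" "\<omega> ^ a * y = \<omega> ^ b * y'"
      using uv by auto
    then have "a = b"
      using less [of a y b y'] less [of b y' a y] by (cases "a \<le> b") auto
    then show "u = v"
      using * \<omega>0 by (simp add: split)
  qed
  moreover have "?f ` ?X = {z. z ^ (q * m) = 1}"
  proof (rule card_subset_eq)
    show "finite {z :: complex. z ^ (q * m) = 1}"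
      using m(2) prime_gt_0_nat [OF q] by (intro finite_roots_unity) (simp add: Suc_le_eq)
    show "?f ` ?X \<subseteq> {z. z ^ (q * m) = 1}"
    proof -
      have "(\<omega> ^ a * y) ^ (q * m) = 1" if "y ^ m = 1" for a y
        using \<omega>(1) that by (metis mult.commute mult_1 power_mult power_mult_distrib power_one)
      then show ?thesis
        by auto
    qed
    show "card (?f ` ?X) = card {z :: complex. z ^ (q * m) = 1}"
      using \<open>inj_on ?f ?X\<close> m(2) prime_gt_0_nat [OF q]
      by (simp add: card_image card_cartesian_product card_roots_unity_eq)
  qed
  ultimately show ?thesis
    by (simp add: bij_betw_def)
qed

text \<open>
  A relation with slice sums \<open>c a\<close> has \<open>c a = c\<close> for all \<open>a\<close> and some \<open>c\<close>, which is then a common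
  signed sum of all slices. If this forces \<open>c = 0\<close>, the relation splits into relations within the
  slices. Conversely, equal signed sums \<open>c\<close> of all slices combine into a relation since
  \<open>\<Sum>a<q. \<omega> ^ a = 0\<close>; if the whole set is quasi-independent, its coefficients vanish, so \<open>c = 0\<close>.
\<close>

lemma quasi_independent_slices_iff:
  fixes \<omega> :: complex and A :: "nat \<Rightarrow> complex set"
  assumes q: "prime q" and m: "coprime q m" "m > 0" and \<omega>: "\<omega> ^ q = 1" "\<omega> \<noteq> 1"
    and A: "\<And>a. a < q \<Longrightarrow> A a \<subseteq> {y. y ^ m = 1}"
  shows "quasi_independent ((\<lambda>(a, y). \<omega> ^ a * y) ` Sigma {..<q} A) \<longleftrightarrow>
    (\<forall>a<q. quasi_independent (A a)) \<and> (\<Inter>a<q. signed_sums (A a)) \<subseteq> {0}"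
proof -
  have q0: "q > 0"
    using prime_gt_0_nat [OF q] .
  have finA: "finite (A a)" if "a < q" for a
    using A [OF that] finite_roots_unity [of m] m(2) finite_subset by fastforce
  then have fin: "finite (Sigma {..<q} A)"
    by auto
  have "Sigma {..<q} A \<subseteq> {..<q} \<times> {y. y ^ m = 1}"
    using A by auto
  then have inj: "inj_on (\<lambda>(a, y). \<omega> ^ a * y) (Sigma {..<q} A)"
    using bij_betw_root_slices [OF q m \<omega>] by (meson bij_betw_imp_inj_on inj_on_subset)
  have total: "(\<Sum>i\<in>Sigma {..<q} A. of_int (E i) * (case i of (a, y) \<Rightarrow> \<omega> ^ a * y))
      = (\<Sum>a<q. \<omega> ^ a * (\<Sum>y\<in>A a. of_int (E (a, y)) * y))" for E :: "nat \<times> complex \<Rightarrow> int"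
    using finA by (simp add: sum_distrib_left mult_ac case_prod_unfold sum.Sigma)
  show ?thesis
    unfolding quasi_independent_image_iff [OF fin inj] total
  proof (intro iffI conjI allI impI)
    assume ind: "\<forall>E. (\<forall>i\<in>Sigma {..<q} A. E i \<in> {0, 1, - 1}) \<and>
      (\<Sum>a<q. \<omega> ^ a * (\<Sum>y\<in>A a. of_int (E (a, y)) * y)) = 0 \<longrightarrow> (\<forall>i\<in>Sigma {..<q} A. E i = 0)"
    show "quasi_independent (A a)" if a: "a < q" for a
      unfolding quasi_independent_iff [OF finA [OF a]]
    proof (intro allI impI, elim conjE)
      fix e :: "complex \<Rightarrow> int"
      assume e: "\<forall>y\<in>A a. e y \<in> {0, 1, -1}" "(\<Sum>y\<in>A a. of_int (e y) * y) = 0"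
      define E where "E = (\<lambda>(b, y). if b = a then e y else 0)"
      have "(\<Sum>y\<in>A b. of_int (E (b, y)) * y) = 0" for b
        using e(2) by (cases "b = a") (simp_all add: E_def)
      moreover have "\<forall>i\<in>Sigma {..<q} A. E i \<in> {0, 1, - 1}"
        using e(1) by (auto simp: E_def)
      ultimately have "\<forall>i\<in>Sigma {..<q} A. E i = 0"
        using ind by simp
      then show "\<forall>y\<in>A a. e y = 0"
        using a by (force simp: E_def)
    qed
    show "(\<Inter>a<q. signed_sums (A a)) \<subseteq> {0}"
    proof
      fix c
      assume "c \<in> (\<Inter>a<q. signed_sums (A a))"
      then have "\<forall>a. \<exists>e. a < q \<longrightarrow> (\<forall>y\<in>A a. e y \<in> {0, 1, -1}) \<and> c = (\<Sum>y\<in>A a. of_int (e y) * y)"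
        by (force simp: signed_sums_def)
      then obtain e where "\<And>a. a < q \<Longrightarrow> (\<forall>y\<in>A a. e a y \<in> {0, 1, -1}) \<and> c = (\<Sum>y\<in>A a. of_int (e a y) * y)"
        by metis
      then have e_values: "\<And>a y. a < q \<Longrightarrow> y \<in> A a \<Longrightarrow> e a y \<in> {0, 1, -1}"
        and sums: "\<And>a. a < q \<Longrightarrow> (\<Sum>y\<in>A a. of_int (e a y) * y) = c"
        by blast+
      let ?E = "\<lambda>(a, y). e a y"
      have "(\<Sum>a<q. \<omega> ^ a * (\<Sum>y\<in>A a. of_int (e a y) * y)) = (\<Sum>a<q. \<omega> ^ a) * c"
        using sums by (simp add: sum_distrib_right)
      then have "(\<Sum>a<q. \<omega> ^ a * (\<Sum>y\<in>A a. of_int (?E (a, y)) * y)) = 0"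
        by (simp add: sum_root_powers [OF \<omega>])
      moreover have "\<forall>i\<in>Sigma {..<q} A. ?E i \<in> {0, 1, -1}"
        using e_values by auto
      ultimately have "\<forall>i\<in>Sigma {..<q} A. ?E i = 0"
        using ind by blast
      then have "\<forall>y\<in>A 0. e 0 y = 0"
        using q0 by auto
      then show "c \<in> {0}"
        using sums [OF q0] by simp
    qed
  next
    fix E :: "nat \<times> complex \<Rightarrow> int"
    assume "(\<forall>a<q. quasi_independent (A a)) \<and> (\<Inter>a<q. signed_sums (A a)) \<subseteq> {0}"
    then have qi: "\<And>a. a < q \<Longrightarrow> quasi_independent (A a)" and common: "(\<Inter>a<q. signed_sums (A a)) \<subseteq> {0}"
      by auto
    assume "(\<forall>i\<in>Sigma {..<q} A. E i \<in> {0, 1, - 1}) \<and>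
      (\<Sum>a<q. \<omega> ^ a * (\<Sum>y\<in>A a. of_int (E (a, y)) * y)) = 0"
    then have E: "\<And>a y. a < q \<Longrightarrow> y \<in> A a \<Longrightarrow> E (a, y) \<in> {0, 1, -1}"
      and rel: "(\<Sum>a<q. \<omega> ^ a * (\<Sum>y\<in>A a. of_int (E (a, y)) * y)) = 0"
      by auto
    define c where "c = (\<Sum>y\<in>A 0. of_int (E (0, y)) * y)"
    have c: "(\<Sum>y\<in>A a. of_int (E (a, y)) * y) = c" if "a < q" for a
      unfolding c_def
      using slice_sums_equal [where A = A and e = "\<lambda>a y. E (a, y)" and a = a and b = 0, OF q m \<omega> A] rel that q0 by simp
    have "c \<in> signed_sums (A a)" if "a < q" for a
      using c [OF that] E that unfolding signed_sums_def by (auto intro!: exI [of _ "\<lambda>y. E (a, y)"])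
    then have "c = 0"
      using common by auto
    show "\<forall>i\<in>Sigma {..<q} A. E i = 0"
    proof
      fix i
      assume "i \<in> Sigma {..<q} A"
      then obtain a y where i: "i = (a, y)" and a: "a < q" and y: "y \<in> A a"
        by blast
      have "\<forall>y\<in>A a. E (a, y) \<in> {0, 1, -1}" "(\<Sum>y\<in>A a. of_int (E (a, y)) * y) = 0"
        using E a c [of a] \<open>c = 0\<close> by auto
      then have "\<forall>y\<in>A a. E (a, y) = 0"
        using qi [of a] finA [of a] a
        by (auto simp: quasi_independent_iff dest!: spec [of _ "\<lambda>y. E (a, y)"])
      then show "E i = 0"
        using y i by blast
    qed
  qed
qed

section \<open>Lower bounds for Psi\<close>

lemma Psi_ge_sum_slices:
  fixes A :: "nat \<Rightarrow> complex set"
  assumes q: "prime q" and m: "coprime q m" "m > 0"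
    and A: "\<And>a. a < q \<Longrightarrow> A a \<subseteq> {y. y ^ m = 1}"
    and qi: "\<And>a. a < q \<Longrightarrow> quasi_independent (A a)"
    and common: "(\<Inter>a<q. signed_sums (A a)) \<subseteq> {0}"
  shows "(\<Sum>a<q. card (A a)) \<le> Psi (q * m)"
proof -
  obtain \<omega> :: complex where \<omega>: "\<omega> ^ q = 1" "\<omega> \<noteq> 1"
    using prime_root_exists [OF q] .
  let ?D = "(\<lambda>(a, y). \<omega> ^ a * y) ` Sigma {..<q} A"
  have sub: "Sigma {..<q} A \<subseteq> {..<q} \<times> {y. y ^ m = 1}"
    using A by auto
  note bij = bij_betw_root_slices [OF q m \<omega>]
  have "?D \<subseteq> {z. z ^ (q * m) = 1}"
    using image_mono [OF sub, of "\<lambda>(a, y). \<omega> ^ a * y"] bij_betw_imp_surj_on [OF bij] by simp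
  moreover have "quasi_independent ?D"
    using quasi_independent_slices_iff [where A = A, OF q m \<omega> A] qi common by blast
  moreover have "q * m > 0"
    using prime_gt_0_nat [OF q] m(2) by simp
  ultimately have "card ?D \<le> Psi (q * m)"
    by (intro Psi_attained(2))
  moreover have "finite (A a)" if "a < q" for a
    using A [OF that] finite_roots_unity [of m] m(2) finite_subset by fastforce
  then have "card ?D = (\<Sum>a<q. card (A a))"
    using inj_on_subset [OF bij_betw_imp_inj_on [OF bij] sub] by (simp add: card_image)
  ultimately show ?thesis
    by simp
qed

text \<open>
  This is the converse of the previous construction, applied to an optimal set for \<open>p * m\<close>: slicing
  it gives a family that can be extended to a larger number of slices.
\<close>

lemma Psi_slices:
  assumes p: "prime p" and m: "coprime p m" "m > 0"
  obtains A :: "nat \<Rightarrow> complex set" where "\<And>a. a < p \<Longrightarrow> A a \<subseteq> {y. y ^ m = 1}"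
    "\<And>a. a < p \<Longrightarrow> quasi_independent (A a)" "(\<Inter>a<p. signed_sums (A a)) \<subseteq> {0}"
    "(\<Sum>a<p. card (A a)) = Psi (p * m)"
proof -
  obtain \<omega> :: complex where \<omega>: "\<omega> ^ p = 1" "\<omega> \<noteq> 1"
    using prime_root_exists [OF p] .
  let ?f = "\<lambda>(a, y). \<omega> ^ a * y"
  have "p * m > 0"
    using prime_gt_0_nat [OF p] m(2) by simp
  then obtain B where B: "B \<subseteq> {z. z ^ (p * m) = 1}" "quasi_independent B" "card B = Psi (p * m)"
    using Psi_attained(1) by blast
  define A where "A a = {y. y ^ m = 1 \<and> \<omega> ^ a * y \<in> B}" for a
  have sub: "Sigma {..<p} A \<subseteq> {..<p} \<times> {y. y ^ m = 1}"
    by (auto simp: A_def)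
  note bij = bij_betw_root_slices [OF p m \<omega>]
  have image: "?f ` Sigma {..<p} A = B"
  proof
    show "B \<subseteq> ?f ` Sigma {..<p} A"
    proof
      fix z
      assume "z \<in> B"
      then have "z \<in> ?f ` ({..<p} \<times> {y. y ^ m = 1})"
        using B(1) bij_betw_imp_surj_on [OF bij] by auto
      then show "z \<in> ?f ` Sigma {..<p} A"
        using \<open>z \<in> B\<close> by (force simp: A_def)
    qed
  qed (auto simp: A_def)
  have sliceA: "\<And>a. a < p \<Longrightarrow> A a \<subseteq> {y. y ^ m = 1}"
    by (auto simp: A_def)
  have "(\<forall>a<p. quasi_independent (A a)) \<and> (\<Inter>a<p. signed_sums (A a)) \<subseteq> {0}"
    using quasi_independent_slices_iff [where A = A, OF p m \<omega> sliceA] B(2) unfolding image by blast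
  moreover have "finite (A a)" for a
    using finite_roots_unity [of m] m(2) by (auto simp: A_def intro: finite_subset [of _ "{y. y ^ m = 1}"])
  then have "card (?f ` Sigma {..<p} A) = (\<Sum>a<p. card (A a))"
    using inj_on_subset [OF bij_betw_imp_inj_on [OF bij] sub] by (simp add: card_image)
  then have "(\<Sum>a<p. card (A a)) = Psi (p * m)"
    using B(3) unfolding image by simp
  ultimately show thesis
    using that [of A] sliceA by blast
qed

text \<open>
  Additional slices can only shrink the set of common signed sums. So \<open>q - p\<close> copies of an optimal
  set for \<open>m\<close> may be added to the slices of an optimal set for \<open>p * m\<close>.
\<close>

lemma Psi_replace_prime:
  assumes "prime p" "prime q" "p \<le> q" "coprime p m" "coprime q m" "m > 0"
  shows "Psi (p * m) + (q - p) * Psi m \<le> Psi (q * m)"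
proof -
  obtain A where A: "\<And>a. a < p \<Longrightarrow> A a \<subseteq> {y. y ^ m = 1}" "\<And>a. a < p \<Longrightarrow> quasi_independent (A a)"
    "(\<Inter>a<p. signed_sums (A a)) \<subseteq> {0}" "(\<Sum>a<p. card (A a)) = Psi (p * m)"
    using Psi_slices [OF assms(1,4,6)] by blast
  obtain M where M: "M \<subseteq> {y. y ^ m = 1}" "quasi_independent M" "card M = Psi m"
    using Psi_attained(1) [OF assms(6)] by blast
  define A' where "A' a = (if a < p then A a else M)" for a
  have "(\<Inter>a<q. signed_sums (A' a)) \<subseteq> (\<Inter>a<p. signed_sums (A a))"
  proof
    fix c
    assume c: "c \<in> (\<Inter>a<q. signed_sums (A' a))"
    have "c \<in> signed_sums (A a)" if "a < p" for a
    proof -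
      have "c \<in> signed_sums (A' a)"
        using c that \<open>p \<le> q\<close> by auto
      then show ?thesis
        using that by (simp add: A'_def)
    qed
    then show "c \<in> (\<Inter>a<p. signed_sums (A a))"
      by blast
  qed
  then have "(\<Sum>a<q. card (A' a)) \<le> Psi (q * m)"
    using A M assms by (intro Psi_ge_sum_slices) (auto simp: A'_def)
  moreover have "(\<Sum>a<q. card (A' a)) = (\<Sum>a<p. card (A' a)) + (\<Sum>a=p..<q. card (A' a))"
    using \<open>p \<le> q\<close> by (simp add: lessThan_atLeast0 sum.atLeastLessThan_concat)
  moreover have "(\<Sum>a<p. card (A' a)) = Psi (p * m)"
    using A(4) by (simp add: A'_def)
  moreover have "(\<Sum>a=p..<q. card (A' a)) = (q - p) * Psi m"
    using M(3) by (simp add: A'_def)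
  ultimately show ?thesis
    by simp
qed

text \<open>
  When one slice is empty, \<open>0\<close> is its only signed sum, so the other \<open>q - 1\<close> slices can all be the
  same optimal set for \<open>m\<close>.
\<close>

lemma Psi_times_prime:
  assumes q: "prime q" and m: "coprime q m" "m > 0"
  shows "(q - 1) * Psi m \<le> Psi (q * m)"
proof -
  obtain M where M: "M \<subseteq> {y. y ^ m = 1}" "quasi_independent M" "card M = Psi m"
    using Psi_attained(1) [OF m(2)] by blast
  define A where "A a = (if a = (0 :: nat) then {} else M)" for a
  have "quasi_independent {}"
    by (auto simp: quasi_independent_def)
  have "(\<Inter>a<q. signed_sums (A a)) \<subseteq> signed_sums (A 0)"
    using prime_gt_0_nat [OF q] by auto
  also have "\<dots> = {0}"
    by (simp add: A_def signed_sums_def)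
  finally have "(\<Sum>a<q. card (A a)) \<le> Psi (q * m)"
    using M \<open>quasi_independent {}\<close> by (intro Psi_ge_sum_slices [OF q m]) (auto simp: A_def)
  moreover have "(\<Sum>a<q. card (A a)) = (\<Sum>a\<in>{..<q} - {0}. card (A a))"
    by (rule sum.mono_neutral_right) (auto simp: A_def)
  moreover have "\<dots> = (q - 1) * Psi m"
    using M(3) prime_gt_0_nat [OF q] by (simp add: A_def)
  ultimately show ?thesis
    by simp
qed

text \<open>
  At each prime \<open>q\<close> the totient is multiplied by \<open>q - 1\<close> and \<open>Psi\<close> grows by at least this factor.
\<close>

lemma totient_le_Psi:
  assumes "finite P" "\<And>r. r \<in> P \<Longrightarrow> prime r"
  shows "totient (\<Prod>P) \<le> Psi (\<Prod>P)"
  using assms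
proof (induction P)
  case empty
  have "quasi_independent {1}"
    by (auto simp: quasi_independent_iff)
  then have "card {1 :: complex} \<le> Psi 1"
    by (intro Psi_attained(2)) auto
  then show ?case
    by simp
next
  case (insert q P)
  have "coprime q (\<Prod>P)"
    using insert by (intro prod_coprime_right) (metis insertCI primes_coprime)
  moreover have "\<Prod>P > 0"
    using insert.prems by (intro prod_pos) (auto intro: prime_gt_0_nat)
  ultimately have "(q - 1) * Psi (\<Prod>P) \<le> Psi (q * \<Prod>P)"
    using insert.prems by (intro Psi_times_prime) auto
  moreover have "totient (q * \<Prod>P) = (q - 1) * totient (\<Prod>P)"
    using \<open>coprime q (\<Prod>P)\<close> insert.prems by (simp add: totient_mult_coprime totient_prime)
  moreover have "totient (\<Prod>P) \<le> Psi (\<Prod>P)"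
    using insert by auto
  ultimately show ?case
    using insert.hyps by (simp add: order_trans [OF mult_le_mono2])
qed

theorem theorem1p2p2:
  fixes p :: "nat \<Rightarrow> nat" and K n s q m :: nat and \<Delta> :: real
  assumes "\<And>j. j \<in> {1..K} \<Longrightarrow> prime (p j)"
    and "strict_mono_on {1..K} p"
    and "n = (\<Prod>j=1..K. p j)"
    and "s \<in> {1..K}"
    and "prime q"
    and "s = K \<Longrightarrow> p K < q"
    and "s < K \<Longrightarrow> p s < q \<and> q \<notin> p ` {s+1..K}"
    and "m = n div p s"
    and "\<Delta> \<ge> 0"
  shows "real (Psi (q * m)) \<ge> real (Psi n) + (real q - real (p s)) * real (Psi m)
    \<and> (real (Psi n) \<ge> real (totient n) + \<Delta> \<longrightarrow>
         real (Psi (q * m)) \<ge> real (totient (q * m)) + \<Delta>)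
    \<and> (real (Psi n) \<ge> (real (p s) - 1) * real (Psi m) + \<Delta> \<longrightarrow>
         real (Psi (q * m)) \<ge> (real q - 1) * real (Psi m) + \<Delta>)"
proof -
  have ps: "prime (p s)" and q: "prime q" and less: "p s < q"
    using assms(1,4-7) by (auto simp: le_less)
  define P where "P = p ` ({1..K} - {s})"
  have inj: "inj_on p {1..K}"
    using assms(2) by (rule strict_mono_on_imp_inj_on)
  have P: "finite P" "\<And>r. r \<in> P \<Longrightarrow> prime r"
    using assms(1) by (auto simp: P_def)
  have "p s \<notin> P"
    using inj_on_image_mem_iff [OF inj assms(4), of "{1..K} - {s}"] by (simp add: P_def)
  have "q \<notin> P"
  proof
    assume "q \<in> P"
    then obtain j where j: "j \<in> {1..K}" "j \<noteq> s" "q = p j"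
      unfolding P_def by blast
    show False
    proof (cases "j < s")
      case True
      then show ?thesis
        using strict_mono_onD [OF assms(2) j(1) assms(4)] j(3) less by simp
    next
      case False
      then show ?thesis
        using j assms(7) by auto
    qed
  qed
  have "n = p s * (\<Prod>j\<in>{1..K} - {s}. p j)"
    unfolding assms(3) using assms(4) by (intro prod.remove) auto
  also have "(\<Prod>j\<in>{1..K} - {s}. p j) = \<Prod>P"
    unfolding P_def using inj by (subst prod.reindex) (auto intro: inj_on_subset)
  finally have n: "n = p s * m" and m: "m = \<Prod>P"
    using assms(8) prime_gt_0_nat [OF ps] by auto
  have "coprime r m" if "prime r" "r \<notin> P" for r
    unfolding m using that P(2) by (intro prod_coprime_right) (metis primes_coprime)
  then have cop: "coprime (p s) m" "coprime q m"
    using ps q \<open>p s \<notin> P\<close> \<open>q \<notin> P\<close> by auto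
  have "m > 0"
    unfolding m using P(2) by (intro prod_pos) (auto intro: prime_gt_0_nat)
  have "real (Psi n + (q - p s) * Psi m) \<le> real (Psi (q * m))"
    unfolding n of_nat_le_iff using ps q less cop \<open>m > 0\<close> by (intro Psi_replace_prime) auto
  then have 1: "real (Psi (q * m)) \<ge> real (Psi n) + (real q - real (p s)) * real (Psi m)"
    using less by (simp add: of_nat_diff)
  have tot: "real (totient (r * m)) = (real r - 1) * real (totient m)" if "prime r" "coprime r m" for r
    using that prime_gt_0_nat [of r] by (simp add: totient_mult_coprime totient_prime of_nat_diff Suc_leI)
  have "real (totient m) \<le> real (Psi m)"
    using totient_le_Psi [OF P] m by simp
  then have "(real q - real (p s)) * real (totient m) \<le> (real q - real (p s)) * real (Psi m)"
    using less by (intro mult_left_mono) auto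
  then have 2: "real (Psi (q * m)) \<ge> real (totient (q * m)) + \<Delta>" if "real (Psi n) \<ge> real (totient n) + \<Delta>"
    using 1 that tot [OF ps cop(1)] tot [OF q cop(2)] n by (simp add: algebra_simps)
  have 3: "real (Psi (q * m)) \<ge> (real q - 1) * real (Psi m) + \<Delta>"
    if "real (Psi n) \<ge> (real (p s) - 1) * real (Psi m) + \<Delta>"
    using 1 that by (simp add: algebra_simps)
  show ?thesis
    using 1 2 3 by blast
qed

end
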